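(* Let $h\in\mathbb{C}\setminus\{0\}$ and $s\in\mathbb{N}$, and let $\mathscr{A}_{s;h}$ be the unital associative $\mathbb{C}$-algebra generated by two variables $U$ and $V$ satisfying the commutation relation $UV-VU=h\,U^s$. Then for every integer $n\ge1$, the normal ordered form of $(VU)^n$ in $\mathscr{A}_{s;h}$ is $$(VU)^n=\sum_{k=1}^n \mathfrak{S}_{s;h}(n,k)\,V^{k}\,U^{s(n-k)+k},$$ where $\mathfrak{S}_{s;h}(n,k)$ are the generalized Stirling numbers of Mansour and Schork.
   Context: Here $\mathbb{N}$ denotes the nonnegative integers, and $U^0=V^0=1$. The generalized Stirling numbers $\mathfrak{S}_{s;h}(n,k)\in\mathbb{C}$ of Mansour and Schork are determined by $\mathfrak{S}_{s;h}(1,1)=1$, by $\mathfrak{S}_{s;h}(n,k)=0$ whenever $n\ge1$ and $k<1$ or $k>n$, and by the recurrence $$\mathfrak{S}_{s;h}(n+1,k)=\mathfrak{S}_{s;h}(n,k-1)+h\bigl(k+s(n-k)\bigr)\,\mathfrak{S}_{s;h}(n,k)\qquad(n\ge1,\ 1\le k\le n+1).$$ Normal ordered form means an expression as a linear combination of monomials $V^iU^j$, with all powers of $V$ to the left of all powers of $U$. *)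

theory Defs
  imports Complex_Main "HOL-Library.Poly_Mapping" "HOL-Algebra.QuotRing" "HOL-Algebra.Module"
begin

text \<open>Words in the two letters form the free monoid, written additively: the zero is the empty
  word, addition is concatenation. With this monoid as exponents, the convolution product of
  \<^type>\<open>poly_mapping\<close> is the product of the free (noncommutative) algebra.\<close>

datatype letter = LetterU | LetterV

datatype word = Word (letters: "letter list")

instantiation word :: monoid_add
begin

definition zero_word :: word where
  "zero_word = Word []"

definition plus_word :: "word \<Rightarrow> word \<Rightarrow> word" where
  "plus_word v w = Word (letters v @ letters w)"

instance
  by standard (simp_all add: zero_word_def plus_word_def)

end

type_synonym free_poly = "word \<Rightarrow>\<^sub>0 complex"

definition free_alg :: "free_poly ring" where
  "free_alg = \<lparr>carrier = UNIV, mult = (*), one = 1, zero = 0, add = (+)\<rparr>"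

definition free_const :: "complex \<Rightarrow> free_poly" where
  "free_const c = Poly_Mapping.single 0 c"

definition free_U :: free_poly where
  "free_U = Poly_Mapping.single (Word [LetterU]) 1"

definition free_V :: free_poly where
  "free_V = Poly_Mapping.single (Word [LetterV]) 1"

definition rel_ideal :: "nat \<Rightarrow> complex \<Rightarrow> free_poly set" where
  "rel_ideal s h =
     Idl\<^bsub>free_alg\<^esub> {free_U * free_V - free_V * free_U - free_const h * free_U ^ s}"

definition alg_of :: "nat \<Rightarrow> complex \<Rightarrow> free_poly \<Rightarrow> free_poly set" where
  "alg_of s h p = rel_ideal s h +>\<^bsub>free_alg\<^esub> p"

text \<open>The algebra \<open>\<A>\<^sub>s\<^sub>;\<^sub>h\<close>. The locales for modules and algebras over a ring use the record type
  \<^typ>\<open>('a, 'b) module\<close>; the scalar \<open>c\<close> acts as multiplication by the image of the constant \<open>c\<close>.\<close>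

definition alg :: "nat \<Rightarrow> complex \<Rightarrow> (complex, free_poly set) module" where
  "alg s h = (let Q = free_alg Quot rel_ideal s h in
     \<lparr>carrier = carrier Q, mult = mult Q, one = one Q, zero = zero Q, add = add Q,
      smult = (\<lambda>c x. alg_of s h (free_const c) \<otimes>\<^bsub>Q\<^esub> x)\<rparr>)"

definition alg_U :: "nat \<Rightarrow> complex \<Rightarrow> free_poly set" where
  "alg_U s h = alg_of s h free_U"

definition alg_V :: "nat \<Rightarrow> complex \<Rightarrow> free_poly set" where
  "alg_V s h = alg_of s h free_V"

text \<open>Only \<open>n \<ge> 1\<close> is meaningful; the value at \<open>n = 0\<close> is a dummy and enters no other value.
  The factor \<open>n - k\<close> is taken in \<^typ>\<open>complex\<close>, since \<open>k = n + 1\<close> is allowed in the recurrence.\<close>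

fun gen_stirling :: "nat \<Rightarrow> complex \<Rightarrow> nat \<Rightarrow> nat \<Rightarrow> complex" where
  "gen_stirling s h 0 k = 0"
| "gen_stirling s h (Suc 0) k = (if k = 1 then 1 else 0)"
| "gen_stirling s h (Suc (Suc m)) k =
     (if 1 \<le> k \<and> k \<le> Suc (Suc m)
      then gen_stirling s h (Suc m) (k - 1)
           + h * (of_nat k + of_nat s * (of_nat (Suc m) - of_nat k)) * gen_stirling s h (Suc m) k
      else 0)"

lemma gen_stirling_1_1: "gen_stirling s h 1 1 = 1"
  by simp

lemma gen_stirling_eq_0: "n \<ge> 1 \<Longrightarrow> k < 1 \<or> k > n \<Longrightarrow> gen_stirling s h n k = 0"
  by (induction s h n k rule: gen_stirling.induct) auto

lemma gen_stirling_rec: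
  assumes "n \<ge> 1" "1 \<le> k" "k \<le> n + 1"
  shows "gen_stirling s h (n + 1) k =
    gen_stirling s h n (k - 1)
    + h * (of_nat k + of_nat s * (of_nat n - of_nat k)) * gen_stirling s h n k"
proof -
  obtain m where "n = Suc m"
    using assms(1) by (cases n) auto
  with assms show ?thesis by simp
qed

lemma ring_free_alg: "ring free_alg"
proof (rule ringI)
  show "abelian_group free_alg"
  proof (rule abelian_groupI)
    fix x assume "x \<in> carrier free_alg"
    show "\<exists>y\<in>carrier free_alg. y \<oplus>\<^bsub>free_alg\<^esub> x = \<zero>\<^bsub>free_alg\<^esub>"
      by (rule bexI[of _ "- x"]) (simp_all add: free_alg_def)
  qed (simp_all add: free_alg_def algebra_simps)
  show "monoid free_alg"
    by (rule monoidI) (simp_all add: free_alg_def algebra_simps)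
qed (simp_all add: free_alg_def algebra_simps)

lemma ideal_rel_ideal: "ideal (rel_ideal s h) free_alg"
  unfolding rel_ideal_def
  by (rule ring.genideal_ideal[OF ring_free_alg]) (simp add: free_alg_def)

lemma alg_of_ring_hom: "alg_of s h \<in> ring_hom free_alg (alg s h)"
  using ideal.rcos_ring_hom[OF ideal_rel_ideal[of s h]]
  by (simp add: ring_hom_def alg_def Let_def alg_of_def [abs_def])

lemma ring_alg: "ring (alg s h)"
proof -
  interpret Q: ring "free_alg Quot rel_ideal s h"
    by (rule ideal.quotient_is_ring[OF ideal_rel_ideal])
  show ?thesis
  proof (rule ringI)
    show "abelian_group (alg s h)"
    proof (rule abelian_groupI)
      fix x assume x: "x \<in> carrier (alg s h)"
      show "\<exists>y\<in>carrier (alg s h). y \<oplus>\<^bsub>alg s h\<^esub> x = \<zero>\<^bsub>alg s h\<^esub>"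
        using x Q.l_neg[of x] Q.a_inv_closed[of x] by (auto simp: alg_def Let_def)
    qed (simp_all add: alg_def Let_def Q.a_assoc, simp add: Q.a_comm)
    show "monoid (alg s h)"
      by (rule monoidI) (simp_all add: alg_def Let_def Q.m_assoc)
  qed (simp_all add: alg_def Let_def Q.l_distr Q.r_distr)
qed

lemma alg_relation:
  "alg_U s h \<otimes>\<^bsub>alg s h\<^esub> alg_V s h \<ominus>\<^bsub>alg s h\<^esub> alg_V s h \<otimes>\<^bsub>alg s h\<^esub> alg_U s h
   = h \<odot>\<^bsub>alg s h\<^esub> (alg_U s h [^]\<^bsub>alg s h\<^esub> s)"
proof -
  let ?A = "alg s h" and ?q = "alg_of s h"
  interpret F: ring free_alg by (rule ring_free_alg)
  interpret A: ring ?A by (rule ring_alg)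
  interpret q: ring_hom_ring free_alg ?A ?q
    by (intro ring_hom_ringI2 ring_free_alg ring_alg alg_of_ring_hom)
  interpret I: ideal "rel_ideal s h" free_alg by (rule ideal_rel_ideal)
  have carr [simp]: "p \<in> carrier free_alg" for p
    by (simp add: free_alg_def)
  have mult: "?q (p * r) = ?q p \<otimes>\<^bsub>?A\<^esub> ?q r" for p r
    using q.hom_mult[of p r] by (simp add: free_alg_def)
  have add: "?q (p + r) = ?q p \<oplus>\<^bsub>?A\<^esub> ?q r" for p r
    using q.hom_add[of p r] by (simp add: free_alg_def)
  have diff: "?q (p - r) = ?q p \<ominus>\<^bsub>?A\<^esub> ?q r" for p r
    using add[of "p - r" r] q.hom_closed[OF carr, of "p - r"] q.hom_closed[OF carr, of p]
      q.hom_closed[OF carr, of r]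
    by (simp add: A.minus_eq A.a_assoc A.r_neg)
  have pow: "?q (p ^ m) = ?q p [^]\<^bsub>?A\<^esub> m" for p m
  proof (induction m)
    case 0
    then show ?case using q.hom_one by (simp add: free_alg_def)
  next
    case (Suc m)
    then show ?case by (simp only: power_Suc2 mult A.nat_pow_Suc)
  qed
  let ?r = "free_U * free_V - free_V * free_U - free_const h * free_U ^ s"
  have "?r \<in> rel_ideal s h"
    unfolding rel_ideal_def by (rule F.genideal_self') simp
  hence "?q ?r = \<zero>\<^bsub>?A\<^esub>"
    using I.a_rcos_const[of ?r] by (simp add: alg_of_def alg_def Let_def FactRing_def)
  hence "?q (free_U * free_V - free_V * free_U) = ?q (free_const h * free_U ^ s)"
    using add[of "free_const h * free_U ^ s" ?r] A.r_zero[OF q.hom_closed[OF carr]] by simp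
  hence "?q free_U \<otimes>\<^bsub>?A\<^esub> ?q free_V \<ominus>\<^bsub>?A\<^esub> ?q free_V \<otimes>\<^bsub>?A\<^esub> ?q free_U
         = ?q (free_const h) \<otimes>\<^bsub>?A\<^esub> (?q free_U [^]\<^bsub>?A\<^esub> s)"
    by (simp only: diff mult pow)
  thus ?thesis
    by (simp add: alg_U_def alg_V_def alg_def Let_def)
qed

end

theory Submission
  imports Defs
begin

text \<open>Moving one \<open>V\<close> to the left past \<open>U\<^sup>m\<close> meets the
  defining relation once for each of the \<open>m\<close> letters \<open>U\<close>, and each meeting leaves the same word
  behind. So one more factor \<open>V U\<close> on the right turns \<open>U\<^sup>m\<close> into
  \<open>U\<^sup>m V U = V U\<^bsup>m+1\<^esup> + h m U\<^bsup>m+s\<^esup>\<close> (lemma \<open>alg_of_U_power_VU\<close>). With \<open>m = s (n - k) + k\<close>, the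
  \<open>k\<close>-th word in the expansion of \<open>(V U)\<^sup>n\<close> becomes the words number \<open>k + 1\<close> and \<open>k\<close> in the
  expansion of \<open>(V U)\<^bsup>n+1\<^esup>\<close>, the latter with the factor \<open>h (k + s (n - k))\<close>. Collecting
  the coefficient of each word gives exactly the recurrence of the generalized Stirling numbers
  (lemma \<open>normal_form_times_VU\<close>), and induction on \<open>n\<close> finishes the proof.

  All computations take place on representatives in the free algebra, which is a type with ring
  operators; equality in the quotient is equality of the images under the projection \<open>alg_of s h\<close>,
  a congruence because the projection is a ring homomorphism.\<close>

lemma free_const_0 [simp]: "free_const 0 = 0"
  by (simp add: free_const_def)

lemma free_const_1 [simp]: "free_const 1 = 1"
  by (simp add: free_const_def)

lemma free_const_add: "free_const (a + b) = free_const a + free_const b"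
  by (simp add: free_const_def single_add)

lemma free_const_mult: "free_const (a * b) = free_const a * free_const b"
  by (simp add: free_const_def mult_single)

text \<open>A scalar is supported on the empty word, the only word that commutes with every other one;
  so scalars are central although the product is not commutative.\<close>

lemma free_const_commute: "free_const a * p = p * free_const a"
proof (induction p rule: update_induct)
  case const
  then show ?case by simp
next
  case (update p w b)
  have "Poly_Mapping.update w b p = p + Poly_Mapping.single w b"
    using update.hyps(1)
    by (intro poly_mapping_eqI) (auto simp: lookup_update lookup_add lookup_single when_def in_keys_iff)
  moreover have "free_const a * Poly_Mapping.single w b = Poly_Mapping.single w b * free_const a"
    by (simp add: free_const_def mult_single mult.commute)
  ultimately show ?case
    using update.IH by (simp add: distrib_left distrib_right)
qed

lemma free_const_left_commute: "p * (free_const a * r) = free_const a * (p * r)"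
  by (metis mult.assoc free_const_commute)

lemma alg_of_closed [simp]: "alg_of s h p \<in> carrier (alg s h)"
  using ring_hom_closed[OF alg_of_ring_hom, of p] by (simp add: free_alg_def)

lemma alg_of_add: "alg_of s h (p + r) = alg_of s h p \<oplus>\<^bsub>alg s h\<^esub> alg_of s h r"
  using ring_hom_add[OF alg_of_ring_hom, of p r] by (simp add: free_alg_def)

lemma alg_of_mult: "alg_of s h (p * r) = alg_of s h p \<otimes>\<^bsub>alg s h\<^esub> alg_of s h r"
  using ring_hom_mult[OF alg_of_ring_hom, of p r] by (simp add: free_alg_def)

lemma alg_of_0: "alg_of s h 0 = \<zero>\<^bsub>alg s h\<^esub>"
  using ring_hom_zero[OF alg_of_ring_hom ring_free_alg ring_alg] by (simp add: free_alg_def)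

lemma alg_of_1: "alg_of s h 1 = \<one>\<^bsub>alg s h\<^esub>"
  using ring_hom_one[OF alg_of_ring_hom] by (simp add: free_alg_def)

lemma alg_of_power: "alg_of s h (p ^ m) = alg_of s h p [^]\<^bsub>alg s h\<^esub> m"
proof -
  interpret A: ring "alg s h" by (rule ring_alg)
  show ?thesis
    by (induction m) (simp_all add: alg_of_1 power_Suc2 alg_of_mult del: power_Suc)
qed

lemma alg_of_sum:
  assumes "finite I"
  shows "alg_of s h (\<Sum>i\<in>I. f i) = (\<Oplus>\<^bsub>alg s h\<^esub>i\<in>I. alg_of s h (f i))"
proof -
  interpret A: ring "alg s h" by (rule ring_alg)
  show ?thesis
    using assms by induction (simp_all add: alg_of_0 alg_of_add)
qed

lemma alg_smult: "a \<odot>\<^bsub>alg s h\<^esub> alg_of s h p = alg_of s h (free_const a * p)"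
  by (simp add: alg_of_mult) (simp add: alg_def Let_def)

text \<open>The relation is available as a difference of cosets; as an equation between two cosets it
  can be rewritten inside products.\<close>

lemma alg_of_U_V:
  "alg_of s h (free_U * free_V) = alg_of s h (free_V * free_U + free_const h * free_U ^ s)"
proof -
  let ?q = "alg_of s h"
  interpret A: ring "alg s h" by (rule ring_alg)
  have "?q (free_U * free_V) \<ominus>\<^bsub>alg s h\<^esub> ?q (free_V * free_U) = ?q (free_const h * free_U ^ s)"
    using alg_relation[of s h]
    by (simp add: alg_U_def alg_V_def alg_smult flip: alg_of_mult alg_of_power)
  then have "?q (free_U * free_V) =
      ?q (free_const h * free_U ^ s) \<oplus>\<^bsub>alg s h\<^esub> ?q (free_V * free_U)"
    by (metis A.minus_eq A.a_assoc A.l_neg A.r_zero A.a_inv_closed alg_of_closed)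
  then show ?thesis
    by (simp add: alg_of_add A.a_comm)
qed

text \<open>The trailing \<open>U\<close> keeps the exponent \<open>m + s\<close> free of the truncated \<open>m - 1\<close> that
  \<open>U\<^sup>m V = V U\<^sup>m + h m U\<^bsup>m-1+s\<^esup>\<close> would need. In the induction, the new \<open>U\<close> on the left passes
  \<open>V\<close> once and contributes one further copy of \<open>h U\<^bsup>m+1+s\<^esup>\<close>.\<close>

lemma alg_of_U_power_VU:
  "alg_of s h (free_U ^ m * (free_V * free_U)) =
   alg_of s h (free_V * free_U ^ Suc m + free_const (h * of_nat m) * free_U ^ (m + s))"
proof (induction m)
  case 0
  then show ?case by simp
next
  case (Suc m)
  let ?q = "alg_of s h" and ?A = "alg s h"
  let ?c = "free_const (h * of_nat m)"
  have "?q (free_U ^ Suc m * (free_V * free_U)) =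
      ?q free_U \<otimes>\<^bsub>?A\<^esub> ?q (free_U ^ m * (free_V * free_U))"
    by (simp add: mult.assoc flip: alg_of_mult)
  also have "\<dots> = ?q (free_U * free_V * free_U ^ Suc m + free_U * (?c * free_U ^ (m + s)))"
    by (simp only: Suc.IH flip: alg_of_mult) (simp only: distrib_left mult.assoc)
  also have "\<dots> = ?q ((free_V * free_U + free_const h * free_U ^ s) * free_U ^ Suc m
      + free_U * (?c * free_U ^ (m + s)))"
    by (simp only: alg_of_add alg_of_mult[of _ _ "free_U * free_V"]
        alg_of_mult[of _ _ "free_V * free_U + _"] alg_of_U_V)
  also have "(free_V * free_U + free_const h * free_U ^ s) * free_U ^ Suc m
      + free_U * (?c * free_U ^ (m + s)) =
      free_V * free_U ^ Suc (Suc m)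
      + (free_const h * free_U ^ (s + Suc m) + ?c * free_U ^ Suc (m + s))"
    by (simp only: free_const_left_commute distrib_right mult.assoc power_add power_Suc add.assoc)
  also have "free_const h * free_U ^ (s + Suc m) + ?c * free_U ^ Suc (m + s) =
      free_const (h * of_nat (Suc m)) * free_U ^ (Suc m + s)"
    by (simp only: add.commute[of s] add_Suc of_nat_Suc distrib_left free_const_add
        distrib_right mult_1_right)
  finally show ?case .
qed

definition normal_form :: "nat \<Rightarrow> complex \<Rightarrow> nat \<Rightarrow> free_poly" where
  "normal_form s h n =
     (\<Sum>k=1..n. free_const (gen_stirling s h n k) * (free_V ^ k * free_U ^ (s * (n - k) + k)))"

text \<open>The word number \<open>k\<close> of the new expansion arises twice: from number \<open>k - 1\<close> when the new \<open>V\<close>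
  passes every \<open>U\<close>, and from number \<open>k\<close> when it is absorbed by one of them through the relation.
  These are the two summands of the Stirling recurrence.\<close>

lemma normal_form_times_VU:
  assumes n: "n \<ge> 1"
  shows "alg_of s h (normal_form s h n * (free_V * free_U)) = alg_of s h (normal_form s h (Suc n))"
proof -
  let ?q = "alg_of s h" and ?A = "alg s h"
  let ?S = "gen_stirling s h n"
  define e where "e k = s * (n - k) + k" for k
  define w where "w k = free_V ^ k * free_U ^ (s * (Suc n - k) + k)" for k
  define b where "b k = h * (of_nat k + of_nat s * (of_nat n - of_nat k))" for k :: nat
  have summand: "?q (free_const (?S k) * (free_V ^ k * free_U ^ e k) * (free_V * free_U)) =
      ?q (free_const (?S k) * w (Suc k) + free_const (b k * ?S k) * w k)"
    if k: "k \<in> {1..n}" for k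
  proof -
    have b: "h * of_nat (e k) = b k"
      using k by (simp add: e_def b_def of_nat_diff add.commute)
    have e: "e k + s = s * (Suc n - k) + k"
      using k by (simp add: e_def Suc_diff_le)
    have "?q (free_const (?S k) * (free_V ^ k * free_U ^ e k) * (free_V * free_U)) =
        ?q (free_const (?S k) * free_V ^ k) \<otimes>\<^bsub>?A\<^esub> ?q (free_U ^ e k * (free_V * free_U))"
      by (simp add: mult.assoc flip: alg_of_mult)
    also have "\<dots> = ?q (free_const (?S k) * free_V ^ k
        * (free_V * free_U ^ Suc (e k) + free_const (b k) * free_U ^ (e k + s)))"
      by (simp only: alg_of_U_power_VU b flip: alg_of_mult)
    also have "free_const (?S k) * free_V ^ k
        * (free_V * free_U ^ Suc (e k) + free_const (b k) * free_U ^ (e k + s)) =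
        free_const (?S k) * w (Suc k) + free_const (b k * ?S k) * w k"
    proof -
      have pass: "free_V ^ k * (free_V * free_U ^ Suc (e k)) = w (Suc k)"
        by (simp add: w_def e_def mult.assoc power_Suc2 del: power_Suc)
      have meet: "free_V ^ k * (free_const (b k) * free_U ^ (e k + s)) = free_const (b k) * w k"
        by (simp only: free_const_left_commute e w_def)
      have "free_const (?S k) * (free_const (b k) * w k) = free_const (b k * ?S k) * w k"
        by (simp only: mult.commute[of "b k"] free_const_mult mult.assoc)
      then show ?thesis
        by (simp only: distrib_left mult.assoc pass meet)
    qed
    finally show ?thesis .
  qed
  \<comment> \<open>Both sums may run up to \<open>n + 1\<close>: the terms added are those with \<open>?S 0\<close> and \<open>?S (n + 1)\<close>,
    which vanish.\<close>
  have up: "(\<Sum>k=1..n. free_const (?S k) * w (Suc k)) =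
      (\<Sum>k=1..Suc n. free_const (?S (k - 1)) * w k)"
  proof -
    have "(\<Sum>k=1..Suc n. free_const (?S (k - 1)) * w k) =
        (\<Sum>k=0..n. free_const (?S k) * w (Suc k))"
      by (simp only: One_nat_def sum.shift_bounds_cl_Suc_ivl diff_Suc_Suc minus_nat.diff_0)
    also have "\<dots> = (\<Sum>k=1..n. free_const (?S k) * w (Suc k))"
      using n by (simp add: sum.atLeast_Suc_atMost[of 0] gen_stirling_eq_0)
    finally show ?thesis ..
  qed
  have stay: "(\<Sum>k=1..n. free_const (b k * ?S k) * w k) =
      (\<Sum>k=1..Suc n. free_const (b k * ?S k) * w k)"
    using n by (simp add: gen_stirling_eq_0)
  have "?q (normal_form s h n * (free_V * free_U)) =
      ?q (\<Sum>k=1..n. free_const (?S k) * (free_V ^ k * free_U ^ e k) * (free_V * free_U))"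
    by (simp add: normal_form_def e_def sum_distrib_right)
  also have "\<dots> = ?q (\<Sum>k=1..n. free_const (?S k) * w (Suc k) + free_const (b k * ?S k) * w k)"
  proof -
    interpret A: ring ?A by (rule ring_alg)
    show ?thesis
      unfolding alg_of_sum[OF finite_atLeastAtMost]
      by (rule A.finsum_cong') (simp_all add: summand)
  qed
  also have "(\<Sum>k=1..n. free_const (?S k) * w (Suc k) + free_const (b k * ?S k) * w k) =
      (\<Sum>k=1..Suc n. free_const (?S (k - 1) + b k * ?S k) * w k)"
    by (simp only: sum.distrib up stay free_const_add distrib_right)
  also have "\<dots> = normal_form s h (Suc n)"
    unfolding normal_form_def
  proof (rule sum.cong)
    fix k assume "k \<in> {1..Suc n}"
    then show "free_const (?S (k - 1) + b k * ?S k) * w k =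
        free_const (gen_stirling s h (Suc n) k) * (free_V ^ k * free_U ^ (s * (Suc n - k) + k))"
      using gen_stirling_rec[of n k s h] n by (simp add: w_def b_def)
  qed simp
  finally show ?thesis .
qed

lemma alg_of_VU_power:
  assumes "n \<ge> 1"
  shows "alg_of s h ((free_V * free_U) ^ n) = alg_of s h (normal_form s h n)"
  using assms
proof (induction n rule: nat_induct_at_least)
  case base
  then show ?case by (simp add: normal_form_def)
next
  case (Suc n)
  have "alg_of s h ((free_V * free_U) ^ Suc n) =
      alg_of s h (normal_form s h n * (free_V * free_U))"
    by (simp only: power_Suc2 alg_of_mult[of _ _ _ "free_V * free_U"] Suc.IH)
  then show ?case
    by (simp only: normal_form_times_VU[OF Suc.hyps])
qed

theorem theorem4p1:
  fixes h :: complex and s n :: nat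
  assumes "h \<noteq> 0" and "n \<ge> 1"
  shows "(alg_V s h \<otimes>\<^bsub>alg s h\<^esub> alg_U s h) [^]\<^bsub>alg s h\<^esub> n =
    (\<Oplus>\<^bsub>alg s h\<^esub>k\<in>{1..n}. gen_stirling s h n k \<odot>\<^bsub>alg s h\<^esub>
       (alg_V s h [^]\<^bsub>alg s h\<^esub> k \<otimes>\<^bsub>alg s h\<^esub> alg_U s h [^]\<^bsub>alg s h\<^esub> (s * (n - k) + k)))"
  unfolding alg_U_def alg_V_def alg_of_mult[symmetric] alg_of_power[symmetric] alg_smult
    alg_of_sum[OF finite_atLeastAtMost, symmetric] alg_of_VU_power[OF assms(2)] normal_form_def
  by (rule refl)

end
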